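(* Let $a,b,c,d>0$ with $ad<bc$, and let $\{W_n(z)\}_{n\ge0}$ be defined by $W_0(z)=1$, $W_1(z)=z$, $W_n(z)=(az+b)W_{n-1}(z)+(cz+d)W_{n-2}(z)$ for $n\ge2$. Let $x_A=-b/a$, $\Delta_\Delta=-a^2d+abc+c^2$, $\Delta_g=(b+c)^2+4d(1-a)$, $x_\Delta^{\pm}=\frac{-ab-2c\pm2\sqrt{\Delta_\Delta}}{a^2}$, $x_g^\pm=\frac{b+c}{2(1-a)}\pm\frac{\sqrt{\Delta_g}}{2|1-a|}$ if $a\ne1$ and $x_g^\pm=-\frac{d}{b+c}$ if $a=1$. Let $u=x_\Delta^-$ if $a\le2$ and $u=x_g^-$ if $a>2$; let $v=x_g^-$ if $a\le1$ and $v=x_g^+$ if $a>1$. Then every polynomial $W_n(z)$ is real-rooted. Let $R_n$ be the zero set of $W_n(z)$ and set \[ J_1=(u,x_A),\quad J_2=(x_A,x_\Delta^+),\quad J_3=(x_\Delta^+,v),\quad J_4=(v,0]. \] Then for all $n\ge1$, $|R_n\cap J_1|=\lfloor n/2\rfloor$ and $|R_n\cap J_2|=\lfloor (n-1)/2\rfloor$, and $|R_{2n}\cap J_3|=|R_{2n-1}\cap J_4|=1$. Moreover, for every $k\in\{1,2\}$, every $j\in\{1,2\}$ and every $n\ge k+1$, the set $R_n\cap J_j$ strictly interlaces $R_{n-k}\cap J_j$ from the left if $n$ is odd, and from the right if $n$ is even.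
   Context: Under $ad<bc$ the numbers $\Delta_\Delta,\Delta_g$ are positive, so all of $x_\Delta^\pm,x_g^\pm$ are real. For finite sets $X,Y\subset\mathbb{R}$ with $|X|-|Y|\in\{0,1\}$: $X$ strictly interlaces $Y$ from the left if the elements $x_i$ of $X$ and $y_j$ of $Y$ can be arranged as $x_1<y_1<x_2<y_2<\cdots$; $X$ strictly interlaces $Y$ from the right if they can be arranged as $x_1>y_1>x_2>y_2>\cdots$. *)

theory Defs
  imports "HOL-Analysis.Analysis" "HOL-Computational_Algebra.Polynomial"
begin

fun W :: "real \<Rightarrow> real \<Rightarrow> real \<Rightarrow> real \<Rightarrow> nat \<Rightarrow> real poly" where
  "W a b c d 0 = 1"
| "W a b c d (Suc 0) = [:0, 1:]"
| "W a b c d (Suc (Suc n)) = [:b, a:] * W a b c d (Suc n) + [:d, c:] * W a b c d n"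

text \<open>All complex zeros are real. Nonzero constants are real-rooted; the zero polynomial is not.\<close>

definition real_rooted :: "real poly \<Rightarrow> bool" where
  "real_rooted p \<longleftrightarrow> (\<forall>z::complex. poly (map_poly complex_of_real p) z = 0 \<longrightarrow> z \<in> \<real>)"

text \<open>The set of real zeros, without multiplicity. For real-rooted polynomials this is the whole
  zero set.\<close>

definition zero_set :: "real poly \<Rightarrow> real set" where
  "zero_set p = {x. poly p x = 0}"

definition x_A :: "real \<Rightarrow> real \<Rightarrow> real" where
  "x_A a b = - b / a"

definition Disc_Delta :: "real \<Rightarrow> real \<Rightarrow> real \<Rightarrow> real \<Rightarrow> real" where
  "Disc_Delta a b c d = - (a^2) * d + a * b * c + c^2"

definition Disc_g :: "real \<Rightarrow> real \<Rightarrow> real \<Rightarrow> real \<Rightarrow> real" where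
  "Disc_g a b c d = (b + c)^2 + 4 * d * (1 - a)"

definition x_Delta_minus :: "real \<Rightarrow> real \<Rightarrow> real \<Rightarrow> real \<Rightarrow> real" where
  "x_Delta_minus a b c d = (- a * b - 2 * c - 2 * sqrt (Disc_Delta a b c d)) / a^2"

definition x_Delta_plus :: "real \<Rightarrow> real \<Rightarrow> real \<Rightarrow> real \<Rightarrow> real" where
  "x_Delta_plus a b c d = (- a * b - 2 * c + 2 * sqrt (Disc_Delta a b c d)) / a^2"

definition x_g_minus :: "real \<Rightarrow> real \<Rightarrow> real \<Rightarrow> real \<Rightarrow> real" where
  "x_g_minus a b c d =
     (if a = 1 then - d / (b + c)
      else (b + c) / (2 * (1 - a)) - sqrt (Disc_g a b c d) / (2 * \<bar>1 - a\<bar>))"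

definition x_g_plus :: "real \<Rightarrow> real \<Rightarrow> real \<Rightarrow> real \<Rightarrow> real" where
  "x_g_plus a b c d =
     (if a = 1 then - d / (b + c)
      else (b + c) / (2 * (1 - a)) + sqrt (Disc_g a b c d) / (2 * \<bar>1 - a\<bar>))"

definition u_bound :: "real \<Rightarrow> real \<Rightarrow> real \<Rightarrow> real \<Rightarrow> real" where
  "u_bound a b c d = (if a \<le> 2 then x_Delta_minus a b c d else x_g_minus a b c d)"

definition v_bound :: "real \<Rightarrow> real \<Rightarrow> real \<Rightarrow> real \<Rightarrow> real" where
  "v_bound a b c d = (if a \<le> 1 then x_g_minus a b c d else x_g_plus a b c d)"

definition J1 :: "real \<Rightarrow> real \<Rightarrow> real \<Rightarrow> real \<Rightarrow> real set" where
  "J1 a b c d = {u_bound a b c d <..< x_A a b}"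

definition J2 :: "real \<Rightarrow> real \<Rightarrow> real \<Rightarrow> real \<Rightarrow> real set" where
  "J2 a b c d = {x_A a b <..< x_Delta_plus a b c d}"

definition J3 :: "real \<Rightarrow> real \<Rightarrow> real \<Rightarrow> real \<Rightarrow> real set" where
  "J3 a b c d = {x_Delta_plus a b c d <..< v_bound a b c d}"

definition J4 :: "real \<Rightarrow> real \<Rightarrow> real \<Rightarrow> real \<Rightarrow> real set" where
  "J4 a b c d = {v_bound a b c d <.. 0}"

text \<open>The lists enumerate the two sets, and \<^term>\<open>splice xs ys\<close> alternates them as
  \<open>x\<^sub>1, y\<^sub>1, x\<^sub>2, y\<^sub>2, \<dots>\<close>. The length condition matters: \<^const>\<open>splice\<close> appends the rest of
  the longer list. Strict sortedness makes both lists distinct, so their lengths are the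
  cardinalities of the sets.\<close>

definition strictly_interlaces_left :: "real set \<Rightarrow> real set \<Rightarrow> bool" where
  "strictly_interlaces_left X Y \<longleftrightarrow>
     (\<exists>xs ys. set xs = X \<and> set ys = Y \<and>
        (length xs = length ys \<or> length xs = Suc (length ys)) \<and>
        sorted_wrt (<) (splice xs ys))"

definition strictly_interlaces_right :: "real set \<Rightarrow> real set \<Rightarrow> bool" where
  "strictly_interlaces_right X Y \<longleftrightarrow>
     (\<exists>xs ys. set xs = X \<and> set ys = Y \<and>
        (length xs = length ys \<or> length xs = Suc (length ys)) \<and>
        sorted_wrt (>) (splice xs ys))"

end

theory Submission
  imports Defs
begin

text \<open>Both intervals \<open>J1\<close> and \<open>J2\<close> carry, after a change of sign and (for \<open>J2\<close>) a reflection
  and an index shift, functions with a recurrence \<open>f (n + 2) = \<alpha> * f (n + 1) - \<beta> * f n\<close>,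
  \<open>\<alpha>, \<beta> > 0\<close>, which are positive at one end of the interval and have sign \<open>(-1) ^ (n div 2)\<close> at
  the other. At a zero of \<open>f (n + 1)\<close> the signs of \<open>f (n + 2)\<close> and \<open>f n\<close> are opposite, so if the
  zeros of \<open>f (n + 1)\<close> and \<open>f n\<close> interlace, \<open>f (n + 2)\<close> changes sign between neighbouring zeros of
  \<open>f (n + 1)\<close>. Together with one zero in \<open>J3\<close> or \<open>J4\<close> this produces \<open>n\<close> real zeros of \<open>W\<^sub>n\<close>.
  Since the degree is \<open>n\<close>, there are no others, and the sign of \<open>W\<^sub>n\<close> at a point is determined by the
  number of zeros above it, which carries the induction on.\<close>

section \<open>Interlacing sequences and lists\<close>

lemma sorted_wrt_splice:
  assumes "transp r" "length xs = length ys \<or> length xs = Suc (length ys)"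
    and "\<And>i. i < length ys \<Longrightarrow> r (xs ! i) (ys ! i)"
    and "\<And>i. Suc i < length xs \<Longrightarrow> r (ys ! i) (xs ! Suc i)"
  shows "sorted_wrt r (splice xs ys)"
  using assms(2-)
proof (induction xs ys rule: splice.induct)
  case (1 ys)
  then show ?case by simp
next
  case (2 x xs ys)
  \<comment> \<open>\<open>splice\<close> swaps its two lists at every recursion, so the two
    neighbour conditions exchange roles.\<close>
  have 3: "sorted_wrt r (splice ys xs)"
  proof (rule 2(1))
    show "length ys = length xs \<or> length ys = Suc (length xs)"
      using 2(2) by auto
    show "r (ys ! i) (xs ! i)" if "i < length xs" for i
      using 2(4)[of i] that by simp
    show "r (xs ! i) (ys ! Suc i)" if "Suc i < length ys" for i
      using 2(3)[of "Suc i"] that by simp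
  qed
  show ?case
  proof (cases ys)
    case Nil
    then show ?thesis using 2(2) by simp
  next
    case (Cons y ys')
    then have "r x y" using 2(3)[of 0] by simp
    then show ?thesis using 3 Cons by (auto dest: transpD[OF assms(1)])
  qed
qed

lemma splice_append_singleton:
  "length xs = length ys \<Longrightarrow> splice (xs @ [x]) ys = splice xs ys @ [x]"
  "length xs = Suc (length ys) \<Longrightarrow> splice xs (ys @ [y]) = splice xs ys @ [y]"
proof (induction xs ys arbitrary: x y rule: splice.induct)
  case (2 x' xs ys)
  { case 1 with 2 show ?case by simp }
  { case 2 with "2.IH" show ?case by simp }
qed simp_all

text \<open>With equal lengths the alternation ends in \<open>ys\<close>, so its reversal starts
  there; with one more entry in \<open>xs\<close> both ends belong to \<open>xs\<close>.\<close>

lemma rev_splice: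
  "length xs = length ys \<Longrightarrow> rev (splice xs ys) = splice (rev ys) (rev xs)"
  "length xs = Suc (length ys) \<Longrightarrow> rev (splice xs ys) = splice (rev xs) (rev ys)"
proof (induction xs ys rule: splice.induct)
  case (2 x xs ys)
  { case 1 with 2 show ?case by (simp add: splice_append_singleton) }
  { case 2 with "2.IH" show ?case by (simp add: splice_append_singleton) }
qed simp_all

lemma map_splice: "map f (splice xs ys) = splice (map f xs) (map f ys)"
  by (induction xs ys rule: splice.induct) auto

lemma strictly_interlaces_leftE:
  assumes "strictly_interlaces_left X Y"
  obtains xs ys where "set xs = X" "set ys = Y" "length xs = card X" "length ys = card Y"
    "card X = card Y \<or> card X = Suc (card Y)" "sorted_wrt (<) (splice xs ys)"
proof -
  from assms obtain xs ys where *: "set xs = X" "set ys = Y"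
    "length xs = length ys \<or> length xs = Suc (length ys)" "sorted_wrt (<) (splice xs ys)"
    by (auto simp: strictly_interlaces_left_def)
  have "distinct (splice xs ys)"
    using *(4) by (simp add: strict_sorted_iff)
  moreover have "mset (splice xs ys) = mset xs + mset ys"
    by (induction xs ys rule: splice.induct) auto
  ultimately have "distinct (xs @ ys)"
    by (metis mset_append mset_eq_imp_distinct_iff)
  then have "length xs = card X" "length ys = card Y"
    using * by (auto simp: distinct_card)
  with * show ?thesis by (intro that[of xs ys]) auto
qed

text \<open>With one element more, \<open>X\<close> occupies both ends of the alternation, which can
  then be read backwards. This supplies the direction of interlacing that the recurrence does not
  give directly.\<close>

lemma strictly_interlaces_right_if_left:
  assumes "strictly_interlaces_left X Y" "card X = Suc (card Y)"
  shows "strictly_interlaces_right X Y"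
proof -
  obtain xs ys where *: "set xs = X" "set ys = Y" "length xs = card X" "length ys = card Y"
    "card X = card Y \<or> card X = Suc (card Y)" "sorted_wrt (<) (splice xs ys)"
    using assms(1) by (rule strictly_interlaces_leftE)
  have "splice (rev xs) (rev ys) = rev (splice xs ys)"
    using rev_splice(2)[of xs ys] * assms(2) by simp
  then have "sorted_wrt (>) (splice (rev xs) (rev ys))"
    using *(6) by (simp only: sorted_wrt_rev)
  then show ?thesis
    unfolding strictly_interlaces_right_def using * assms(2)
    by (intro exI[of _ "rev xs"] exI[of _ "rev ys"]) simp
qed

text \<open>Transports interlacing back through the reflection used for \<open>J2\<close>.\<close>

lemma strictly_interlaces_left_uminus:
  assumes "strictly_interlaces_left X Y"
  shows "strictly_interlaces_right (uminus ` X) (uminus ` Y)"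
proof -
  from assms obtain xs ys where *: "set xs = X" "set ys = Y"
    "length xs = length ys \<or> length xs = Suc (length ys)" "sorted_wrt (<) (splice xs ys)"
    by (auto simp: strictly_interlaces_left_def)
  have "sorted_wrt (>) (splice (map uminus xs) (map uminus ys))"
    using *(4) by (simp add: map_splice[symmetric] sorted_wrt_map)
  then show ?thesis
    unfolding strictly_interlaces_right_def using *
    by (intro exI[of _ "map uminus xs"] exI[of _ "map uminus ys"]) auto
qed

lemma strictly_interlaces_right_uminus:
  assumes "strictly_interlaces_right X Y"
  shows "strictly_interlaces_left (uminus ` X) (uminus ` Y)"
proof -
  from assms obtain xs ys where *: "set xs = X" "set ys = Y"
    "length xs = length ys \<or> length xs = Suc (length ys)" "sorted_wrt (>) (splice xs ys)"
    by (auto simp: strictly_interlaces_right_def)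
  have "sorted_wrt (<) (splice (map uminus xs) (map uminus ys))"
    using *(4) by (simp add: map_splice[symmetric] sorted_wrt_map)
  then show ?thesis
    unfolding strictly_interlaces_left_def using *
    by (intro exI[of _ "map uminus xs"] exI[of _ "map uminus ys"]) auto
qed

text \<open>Turns a position in a sorted list into the count of smaller elements that occurs in
  \<open>tame\<close>.\<close>

lemma card_less_nth:
  fixes xs :: "'a :: linorder list"
  assumes "sorted_wrt (<) xs" "i \<le> length xs"
    and "0 < i \<Longrightarrow> xs ! (i - 1) < y" "i < length xs \<Longrightarrow> y \<le> xs ! i"
  shows "card {x \<in> set xs. x < y} = i"
proof -
  have sorted: "xs ! j < xs ! k \<longleftrightarrow> j < k" if "j < length xs" "k < length xs" for j k
    using assms(1) that by (metis linorder_neqE_nat order_less_asym sorted_wrt_nth_less)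
  have *: "xs ! j < y \<longleftrightarrow> j < i" if "j < length xs" for j
  proof
    assume "xs ! j < y"
    then show "j < i"
    proof (rule contrapos_pp)
      assume "\<not> j < i"
      then have "y \<le> xs ! i"
        using assms(4) that by simp
      moreover have "xs ! i \<le> xs ! j"
        using \<open>\<not> j < i\<close> that sorted[of j i] by (simp add: not_less)
      ultimately show "\<not> xs ! j < y" by auto
    qed
  next
    assume "j < i"
    then have "xs ! (i - 1) < y"
      using assms(3) by simp
    moreover have "xs ! j \<le> xs ! (i - 1)"
      using \<open>j < i\<close> assms(2) sorted[of "i - 1" j] by (simp add: not_less[symmetric])
    ultimately show "xs ! j < y" by auto
  qed
  have "{x \<in> set xs. x < y} = (\<lambda>j. xs ! j) ` {..<i}"
    unfolding set_eq_iff image_iff mem_Collect_eq in_set_conv_nth lessThan_iff Bex_def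
    using * assms(2) by (metis order_less_le_trans)
  moreover have "inj_on (\<lambda>j. xs ! j) {..<i}"
    using assms(1,2) by (intro inj_onI) (simp add: nth_eq_iff_index_eq strict_sorted_iff)
  ultimately show ?thesis by (simp add: card_image)
qed

text \<open>The nodes at which \<open>g\<close> alternates in sign are \<open>l\<close>, the elements of \<open>xs\<close> and, if one more
  zero is wanted than \<open>xs\<close> has elements, \<open>r\<close>.\<close>

lemma alternating_signs_zeros:
  fixes g :: "real \<Rightarrow> real"
  assumes cont: "continuous_on UNIV g"
    and xs: "sorted_wrt (<) xs" "set xs \<subseteq> {l<..<r}" and "l < r"
    and l: "0 < g l" and mid: "\<And>j. j < length xs \<Longrightarrow> 0 < (-1) ^ Suc j * g (xs ! j)"
    and M: "M = length xs \<or> M = Suc (length xs) \<and> 0 < (-1) ^ M * g r"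
  obtains y where "\<And>i. i < M \<Longrightarrow> l < y i \<and> y i < r \<and> g (y i) = 0"
    "\<And>i. i < length xs \<Longrightarrow> y i < xs ! i" "\<And>i. Suc i < M \<Longrightarrow> xs ! i < y (Suc i)"
proof -
  define p where "p i = (if i = 0 then l else if i \<le> length xs then xs ! (i - 1) else r)" for i
  have mem: "l < xs ! j \<and> xs ! j < r" if "j < length xs" for j
    using xs(2) nth_mem[OF that] by auto
  have bounds: "l \<le> p i" "p i \<le> r" for i
    using mem[of "i - 1"] \<open>l < r\<close> by (cases i; force simp: p_def)+
  have p_less: "p i < p (Suc i)" if "i < M" for i
  proof -
    have "i < length xs \<or> i = length xs"
      using M that by auto
    then consider "i = 0" "i < length xs" | "i = 0" "i = length xs" | j where "i = Suc j" "i < length xs"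
      | j where "i = Suc j" "i = length xs"
      by (cases i) auto
    then show ?thesis
    proof cases
      case 3
      then have "xs ! j < xs ! i"
        using sorted_wrt_nth_less[OF xs(1), of j i] by simp
      with 3 show ?thesis by (simp add: p_def)
    qed (use mem[of i] mem[of "i - 1"] \<open>l < r\<close> in \<open>auto simp: p_def\<close>)
  qed
  have sign: "0 < (-1) ^ i * g (p i)" if "i \<le> M" for i
  proof -
    consider "i = 0" | "0 < i" "i \<le> length xs" | "i = M" "M = Suc (length xs)"
      using M \<open>i \<le> M\<close> by linarith
    then show ?thesis
    proof cases
      case 2
      then show ?thesis using mid[of "i - 1"] by (simp add: p_def)
    qed (use l M in \<open>auto simp: p_def\<close>)
  qed
  have "\<exists>y. p i < y \<and> y < p (Suc i) \<and> g y = 0" if "i < M" for i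
  proof -
    have "0 < (-1) ^ i * g (p i)" "(-1) ^ i * g (p (Suc i)) < 0"
      using sign[of i] sign[of "Suc i"] that by auto
    moreover have "continuous_on {p i..p (Suc i)} (\<lambda>x. (-1) ^ i * g x)"
      using cont by (intro continuous_intros continuous_on_subset[OF cont]) auto
    ultimately have "\<exists>y\<ge>p i. y \<le> p (Suc i) \<and> (-1) ^ i * g y = 0"
      using p_less[OF that] by (intro IVT2') auto
    then obtain y where "p i \<le> y" "y \<le> p (Suc i)" "g y = 0"
      by auto
    moreover from this have "y \<noteq> p i" "y \<noteq> p (Suc i)"
      using sign[of i] sign[of "Suc i"] that by auto
    ultimately show ?thesis by (auto intro!: exI[of _ y])
  qed
  then obtain y where y: "\<And>i. i < M \<Longrightarrow> p i < y i \<and> y i < p (Suc i) \<and> g (y i) = 0"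
    by metis
  show thesis
  proof (rule that[of y])
    show "l < y i \<and> y i < r \<and> g (y i) = 0" if "i < M" for i
      using y[OF that] bounds[of i] bounds[of "Suc i"] by linarith
    show "y i < xs ! i" if "i < length xs" for i
      using y[of i] that M by (auto simp: p_def)
    show "xs ! i < y (Suc i)" if "Suc i < M" for i
      using y[OF that] that M by (auto simp: p_def split: if_splits)
  qed
qed

section \<open>Three-term recurrences on an interval\<close>

text \<open>These assumptions serve to produce zeros; the upper bound on their number will come from
  the degree of the polynomials. The exponent \<open>n div 2\<close> makes \<open>r\<close> an extra
  node at every second index.\<close>

locale alternating_recurrence =
  fixes f :: "nat \<Rightarrow> real \<Rightarrow> real" and \<alpha> \<beta> :: "real \<Rightarrow> real" and l r :: real
  assumes l_less_r: "l < r"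
    and cont: "continuous_on UNIV (f n)"
    and rec: "l < x \<Longrightarrow> x < r \<Longrightarrow> f (Suc (Suc n)) x = \<alpha> x * f (Suc n) x - \<beta> x * f n x"
    and \<alpha>_pos: "l < x \<Longrightarrow> x < r \<Longrightarrow> 0 < \<alpha> x"
    and \<beta>_pos: "l < x \<Longrightarrow> x < r \<Longrightarrow> 0 < \<beta> x"
    and f_left: "0 < f n l"
    and f_right: "0 < (-1) ^ (n div 2) * f n r"
begin

definition Z :: "nat \<Rightarrow> real set" where
  "Z n = {x. l < x \<and> x < r \<and> f n x = 0}"

abbreviation zs :: "nat \<Rightarrow> real list" where
  "zs n \<equiv> sorted_list_of_set (Z n)"

text \<open>The sign condition says that the zeros are exactly the sign changes.\<close>

definition tame :: "nat \<Rightarrow> bool" where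
  "tame n \<longleftrightarrow> finite (Z n) \<and> card (Z n) = n div 2 \<and>
     (\<forall>y. l < y \<longrightarrow> y < r \<longrightarrow> f n y \<noteq> 0 \<longrightarrow> 0 < (-1) ^ card {x \<in> Z n. x < y} * f n y)"

lemma
  assumes "tame n"
  shows set_zs: "set (zs n) = Z n"
    and card_Z: "card (Z n) = n div 2"
  using assms by (auto simp: tame_def)

lemma set_zs_subset: "tame n \<Longrightarrow> set (zs n) \<subseteq> {l<..<r}"
  by (subst set_zs) (auto simp: Z_def)

lemma zs_nth:
  assumes "tame n" "i < n div 2"
  shows "l < zs n ! i" "zs n ! i < r" "f n (zs n ! i) = 0"
proof -
  have "zs n ! i \<in> Z n"
    using assms nth_mem[of i "zs n"] by (simp add: set_zs card_Z)
  then show "l < zs n ! i" "zs n ! i < r" "f n (zs n ! i) = 0"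
    by (auto simp: Z_def)
qed

text \<open>A tame index has exactly \<open>n div 2\<close> zeros, so an increasing family of that
  many zeros exhausts them. This transfers inequalities from zeros found by the intermediate value
  theorem to \<open>zs\<close>.\<close>

lemma zs_eqI:
  assumes "tame n" "\<And>i. i < n div 2 \<Longrightarrow> l < y i \<and> y i < r \<and> f n (y i) = 0"
    "\<And>i. Suc i < n div 2 \<Longrightarrow> y i < y (Suc i)" "i < n div 2"
  shows "zs n ! i = y i"
proof -
  have sorted: "sorted_wrt (<) (map y [0..<n div 2])"
    using assms(3) by (simp add: sorted_wrt_iff_nth_Suc_transp)
  have "set (map y [0..<n div 2]) = Z n"
  proof (rule card_subset_eq)
    show "finite (Z n)" using assms(1) by (simp add: tame_def)
    show "set (map y [0..<n div 2]) \<subseteq> Z n" using assms(2) by (auto simp: Z_def)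
    have "card (set (map y [0..<n div 2])) = n div 2"
      using sorted distinct_card[of "map y [0..<n div 2]"] by (simp add: strict_sorted_iff)
    then show "card (set (map y [0..<n div 2])) = card (Z n)"
      using assms(1) by (simp add: tame_def)
  qed
  then have "zs n = map y [0..<n div 2]"
    using sorted by (metis strict_sorted_equal strict_sorted_list_of_set set_zs[OF assms(1)])
  then show ?thesis using assms(4) by simp
qed

text \<open>Strictly between consecutive zeros \<open>y\<close> is no zero itself, and exactly
  \<open>i\<close> zeros lie below it. The cases \<open>i = 0\<close> and \<open>i = n div 2\<close>
  cover the outer gaps.\<close>

lemma sign_between:
  assumes "tame n" "l < y" "y < r" "i \<le> n div 2"
    and "0 < i \<Longrightarrow> zs n ! (i - 1) < y" "i < n div 2 \<Longrightarrow> y < zs n ! i"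
  shows "0 < (-1) ^ i * f n y"
proof -
  have count: "card {x \<in> Z n. x < y} = i"
    using card_less_nth[of "zs n" i y] assms by (simp add: set_zs card_Z less_imp_le)
  have "f n y \<noteq> 0"
  proof
    assume "f n y = 0"
    with assms have "y \<in> set (zs n)" by (subst set_zs) (auto simp: Z_def)
    then obtain j where j: "j < n div 2" "zs n ! j = y"
      using assms(1) by (auto simp: in_set_conv_nth card_Z)
    have mono: "zs n ! p \<le> zs n ! q" if "p \<le> q" "q < n div 2" for p q
      using assms(1) that by (intro sorted_nth_mono) (auto simp: card_Z)
    show False
    proof (cases "j < i")
      case True
      then have "j \<le> i - 1" "i - 1 < n div 2" "0 < i" using assms(4) by linarith+
      then show False using mono[of j "i - 1"] assms(5) j by simp
    next
      case False
      then show False using mono[of i j] assms j by simp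
    qed
  qed
  with assms count show ?thesis by (auto simp: tame_def)
qed

text \<open>Tameness is assumed only up to \<open>n\<close>, so the \<open>y i\<close> are some
  zeros of \<open>f (Suc n)\<close>, possibly not all. Tameness at \<open>Suc n\<close> will later
  be derived from the lower bound obtained here.\<close>

lemma interlacing_zeros_exist:
  assumes "\<And>k. k \<le> n \<Longrightarrow> tame k"
  obtains y where "\<And>i. i < Suc n div 2 \<Longrightarrow> l < y i \<and> y i < r \<and> f (Suc n) (y i) = 0"
    "\<And>i. i < n div 2 \<Longrightarrow> y i < zs n ! i" "\<And>i. Suc i < Suc n div 2 \<Longrightarrow> zs n ! i < y (Suc i)"
  using assms
proof (induction n arbitrary: thesis)
  case 0
  show ?case by (rule "0.prems"(1)) auto
next
  case (Suc n)
  have tame: "tame n" "tame (Suc n)" using Suc.prems(2) by auto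
  obtain y where y: "\<And>i. i < Suc n div 2 \<Longrightarrow> l < y i \<and> y i < r \<and> f (Suc n) (y i) = 0"
    "\<And>i. i < n div 2 \<Longrightarrow> y i < zs n ! i" "\<And>i. Suc i < Suc n div 2 \<Longrightarrow> zs n ! i < y (Suc i)"
    using Suc.IH Suc.prems(2) by (metis le_Suc_eq)
  \<comment> \<open>Now \<open>Suc n\<close> is tame too, so the zeros from the induction hypothesis
    are all zeros of \<open>f (Suc n)\<close> in the interval.\<close>
  have y_eq: "zs (Suc n) ! i = y i" if "i < Suc n div 2" for i
  proof (rule zs_eqI)
    show "y i < y (Suc i)" if "Suc i < Suc n div 2" for i
      using y(2)[of i] y(3)[of i] that by linarith
  qed (use y(1) tame that in auto)
  have sign: "0 < (-1) ^ Suc j * f (Suc (Suc n)) (zs (Suc n) ! j)" if "j < Suc n div 2" for j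
  proof -
    \<comment> \<open>Counting from 0, exactly \<open>j\<close> zeros of \<open>f n\<close> lie
      below the zero of \<open>f (Suc n)\<close> with index \<open>j\<close>. There the \<alpha>
      term vanishes and the \<beta> term flips the sign.\<close>
    have "0 < (-1) ^ j * f n (zs (Suc n) ! j)"
    proof (rule sign_between)
      show "0 < j \<Longrightarrow> zs n ! (j - 1) < zs (Suc n) ! j" "j < n div 2 \<Longrightarrow> zs (Suc n) ! j < zs n ! j"
        using y(2)[of j] y(3)[of "j - 1"] that by (simp_all add: y_eq)
    qed (use tame that zs_nth[OF tame(2)] in auto)
    then have "0 < \<beta> (zs (Suc n) ! j) * ((-1) ^ j * f n (zs (Suc n) ! j))"
      using zs_nth[OF tame(2) that] \<beta>_pos by simp
    then show ?thesis
      using zs_nth[OF tame(2) that] rec[of "zs (Suc n) ! j" n] by (simp add: algebra_simps)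
  qed
  show ?case
  proof (rule alternating_signs_zeros[of "f (Suc (Suc n))" "zs (Suc n)" l r "Suc (Suc n) div 2"])
    show "continuous_on UNIV (f (Suc (Suc n)))" by (rule cont)
    show "set (zs (Suc n)) \<subseteq> {l<..<r}" using tame(2) by (rule set_zs_subset)
    show "Suc (Suc n) div 2 = length (zs (Suc n)) \<or>
        Suc (Suc n) div 2 = Suc (length (zs (Suc n))) \<and>
        0 < (-1) ^ (Suc (Suc n) div 2) * f (Suc (Suc n)) r"
      using f_right[of "Suc (Suc n)"] tame(2) by (auto simp: card_Z)
    show "thesis" if "\<And>i. i < Suc (Suc n) div 2 \<Longrightarrow> l < y i \<and> y i < r \<and> f (Suc (Suc n)) (y i) = 0"
      "\<And>i. i < length (zs (Suc n)) \<Longrightarrow> y i < zs (Suc n) ! i"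
      "\<And>i. Suc i < Suc (Suc n) div 2 \<Longrightarrow> zs (Suc n) ! i < y (Suc i)" for y
      using that tame(2) by (intro Suc.prems(1)[of y]) (auto simp: card_Z)
  qed (use tame(2) sign l_less_r f_left in \<open>simp_all add: card_Z\<close>)
qed

text \<open>The zeros just found are separated by those of the preceding index, hence distinct.
  Tameness is required below \<open>n\<close> only, as fits a strong induction.\<close>

lemma card_Z_ge:
  assumes "\<And>k. k < n \<Longrightarrow> tame k" "finite (Z n)"
  shows "n div 2 \<le> card (Z n)"
proof (cases n)
  case (Suc m)
  obtain y where y: "\<And>i. i < n div 2 \<Longrightarrow> l < y i \<and> y i < r \<and> f n (y i) = 0"
    "\<And>i. i < m div 2 \<Longrightarrow> y i < zs m ! i" "\<And>i. Suc i < n div 2 \<Longrightarrow> zs m ! i < y (Suc i)"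
    using interlacing_zeros_exist[of m] assms(1) Suc by (metis le_imp_less_Suc)
  have "y i < y (Suc i)" if "Suc i < n div 2" for i
    using y(2)[of i] y(3)[of i] that Suc by linarith
  then have "sorted_wrt (<) (map y [0..<n div 2])"
    by (simp add: sorted_wrt_iff_nth_Suc_transp)
  then have "card (set (map y [0..<n div 2])) = n div 2"
    using distinct_card[of "map y [0..<n div 2]"] by (simp add: strict_sorted_iff)
  moreover have "set (map y [0..<n div 2]) \<subseteq> Z n"
    using y(1) by (auto simp: Z_def)
  ultimately show ?thesis
    using card_mono[OF assms(2)] by metis
qed simp

section \<open>Interlacing once every index is tame\<close>

context
  assumes all_tame: "\<And>n. tame n"
begin

lemma interlacing_zs:
  assumes "i < Suc n div 2"
  shows "i < n div 2 \<Longrightarrow> zs (Suc n) ! i < zs n ! i" "0 < i \<Longrightarrow> zs n ! (i - 1) < zs (Suc n) ! i"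
proof -
  obtain y where y: "\<And>i. i < Suc n div 2 \<Longrightarrow> l < y i \<and> y i < r \<and> f (Suc n) (y i) = 0"
    "\<And>i. i < n div 2 \<Longrightarrow> y i < zs n ! i" "\<And>i. Suc i < Suc n div 2 \<Longrightarrow> zs n ! i < y (Suc i)"
    using interlacing_zeros_exist[of n] all_tame by metis
  have "zs (Suc n) ! i = y i"
  proof (rule zs_eqI)
    show "y i < y (Suc i)" if "Suc i < Suc n div 2" for i
      using y(2)[of i] y(3)[of i] that by linarith
  qed (use y(1) all_tame assms in auto)
  then show "i < n div 2 \<Longrightarrow> zs (Suc n) ! i < zs n ! i" "0 < i \<Longrightarrow> zs n ! (i - 1) < zs (Suc n) ! i"
    using y(2)[of i] y(3)[of "i - 1"] assms by simp_all
qed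

lemma strictly_interlaces_Z:
  assumes "k div 2 = n div 2 \<or> k div 2 = Suc (n div 2)"
    and "\<And>i. i < n div 2 \<Longrightarrow> zs k ! i < zs n ! i"
    and "\<And>i. Suc i < k div 2 \<Longrightarrow> zs n ! i < zs k ! Suc i"
  shows "strictly_interlaces_left (Z k) (Z n)"
  unfolding strictly_interlaces_left_def
proof (intro exI conjI)
  have len: "length (zs n) = n div 2" "length (zs k) = k div 2"
    using all_tame by (simp_all add: card_Z)
  show "set (zs k) = Z k" "set (zs n) = Z n"
    using all_tame by (simp_all add: set_zs)
  show "length (zs k) = length (zs n) \<or> length (zs k) = Suc (length (zs n))"
    using assms(1) unfolding len .
  show "sorted_wrt (<) (splice (zs k) (zs n))"
    by (rule sorted_wrt_splice) (use assms in \<open>auto simp only: len transp_on_less\<close>)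
qed

lemma strictly_interlaces_Suc: "strictly_interlaces_left (Z (Suc n)) (Z n)"
proof (rule strictly_interlaces_Z)
  show "zs (Suc n) ! i < zs n ! i" if "i < n div 2" for i
    using interlacing_zs(1)[of i n] that by simp
  show "zs n ! i < zs (Suc n) ! Suc i" if "Suc i < Suc n div 2" for i
    using interlacing_zs(2)[of "Suc i" n] that by simp
qed linarith

text \<open>At a zero of \<open>f n\<close> the recurrence gives \<open>f (n + 2)\<close> the sign of \<open>f (n + 1)\<close>.\<close>

lemma strictly_interlaces_Suc_Suc: "strictly_interlaces_left (Z (Suc (Suc n))) (Z n)"
proof (rule alternating_signs_zeros[of "f (Suc (Suc n))" "zs n" l r "Suc (Suc n) div 2"])
  show "continuous_on UNIV (f (Suc (Suc n)))" by (rule cont)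
  show "set (zs n) \<subseteq> {l<..<r}" using all_tame by (rule set_zs_subset)
  show "0 < (-1) ^ Suc j * f (Suc (Suc n)) (zs n ! j)" if "j < length (zs n)" for j
  proof -
    have j: "j < n div 2" using that all_tame by (simp add: card_Z)
    \<comment> \<open>By interlacing, \<open>zs n ! j\<close> lies above exactly
      \<open>Suc j\<close> zeros of \<open>f (Suc n)\<close>.\<close>
    have "0 < (-1) ^ Suc j * f (Suc n) (zs n ! j)"
    proof (rule sign_between)
      show "zs (Suc n) ! (Suc j - 1) < zs n ! j"
        using interlacing_zs(1)[of j n] j by simp
      show "zs n ! j < zs (Suc n) ! Suc j" if "Suc j < Suc n div 2"
        using interlacing_zs(2)[of "Suc j" n] that by simp
    qed (use all_tame zs_nth[of n j] j in auto)
    moreover have "0 < \<alpha> (zs n ! j)"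
      using zs_nth[OF all_tame j] by (intro \<alpha>_pos)
    ultimately have "0 < \<alpha> (zs n ! j) * ((-1) ^ Suc j * f (Suc n) (zs n ! j))"
      by (rule mult_pos_pos[rotated])
    then show ?thesis
      using zs_nth[OF all_tame j] rec[of "zs n ! j" n] by (simp add: algebra_simps)
  qed
  show "Suc (Suc n) div 2 = length (zs n) \<or>
      Suc (Suc n) div 2 = Suc (length (zs n)) \<and> 0 < (-1) ^ (Suc (Suc n) div 2) * f (Suc (Suc n)) r"
    using f_right[of "Suc (Suc n)"] all_tame by (auto simp: card_Z)
  show "strictly_interlaces_left (Z (Suc (Suc n))) (Z n)"
    if y: "\<And>i. i < Suc (Suc n) div 2 \<Longrightarrow> l < y i \<and> y i < r \<and> f (Suc (Suc n)) (y i) = 0"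
      "\<And>i. i < length (zs n) \<Longrightarrow> y i < zs n ! i"
      "\<And>i. Suc i < Suc (Suc n) div 2 \<Longrightarrow> zs n ! i < y (Suc i)" for y
  proof -
    have len: "length (zs n) = n div 2" using all_tame by (simp add: card_Z)
    have eq: "zs (Suc (Suc n)) ! i = y i" if "i < Suc (Suc n) div 2" for i
    proof (rule zs_eqI)
      show "y i < y (Suc i)" if "Suc i < Suc (Suc n) div 2" for i
        using y(2)[of i] y(3)[of i] that len by simp
    qed (use y(1) all_tame that in auto)
    show ?thesis
    proof (rule strictly_interlaces_Z)
      show "zs (Suc (Suc n)) ! i < zs n ! i" if "i < n div 2" for i
        using y(2)[of i] eq[of i] that len by simp
      show "zs n ! i < zs (Suc (Suc n)) ! Suc i" if "Suc i < Suc (Suc n) div 2" for i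
        using y(3)[of i] eq[of "Suc i"] that by simp
    qed auto
  qed
qed (use l_less_r f_left in simp_all)

end

end

section \<open>Polynomials with only simple real zeros\<close>

text \<open>Both sides have the same leading coefficient and agree at \<open>degree p\<close>
  points, which determines a polynomial of that degree.\<close>

lemma poly_eq_prod_zero_set:
  assumes "p \<noteq> 0" "card (zero_set p) = degree p"
  shows "p = smult (lead_coeff p) (\<Prod>z\<in>zero_set p. [:- z, 1:])" (is "p = ?q")
proof -
  have deg: "degree (\<Prod>z\<in>zero_set p. [:- z, 1:]) = degree p"
    using assms by (subst degree_prod_eq_sum_degree) auto
  have lead: "lead_coeff (\<Prod>z\<in>zero_set p. [:- z, 1:]) = 1"
    by (simp add: lead_coeff_prod)
  have fin: "finite (zero_set p)"
    using assms(1) by (simp add: zero_set_def poly_roots_finite)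
  show ?thesis
  proof (rule poly_eqI_degree_lead_coeff[of _ "degree p" _ "zero_set p"])
    show "coeff p (degree p) = coeff ?q (degree p)"
      using lead by (simp add: deg)
    show "degree ?q \<le> degree p"
      using deg degree_smult_le by metis
    show "poly p z = poly ?q z" if "z \<in> zero_set p" for z
      using that fin by (auto simp: zero_set_def poly_prod)
  qed (use assms(2) in auto)
qed

text \<open>In the factorization exactly the zeros above \<open>y\<close> contribute negative
  factors.\<close>

lemma poly_sign_zero_set:
  assumes "card (zero_set p) = degree p" "0 < lead_coeff p" "poly p y \<noteq> 0"
  shows "0 < (-1) ^ card {z \<in> zero_set p. y < z} * poly p y"
proof -
  have prod: "0 < (-1) ^ card {z \<in> S. y < z} * (\<Prod>z\<in>S. y - z)" if "finite S" "y \<notin> S" for S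
    using that
  proof (induction S rule: finite_induct)
    case (insert w S)
    have "{z \<in> insert w S. y < z} = (if y < w then insert w {z \<in> S. y < z} else {z \<in> S. y < z})"
      by auto
    then have "(-1) ^ card {z \<in> insert w S. y < z} * (\<Prod>z\<in>insert w S. y - z) =
        \<bar>y - w\<bar> * ((-1) ^ card {z \<in> S. y < z} * (\<Prod>z\<in>S. y - z))"
      using insert by (auto simp: algebra_simps)
    moreover have "0 < \<bar>y - w\<bar> * ((-1) ^ card {z \<in> S. y < z} * (\<Prod>z\<in>S. y - z))"
      using insert mult_pos_pos[of "\<bar>y - w\<bar>"] by simp
    ultimately show ?case by simp
  qed simp
  have "p \<noteq> 0" using assms(2) by auto
  then have "finite (zero_set p)" by (simp add: zero_set_def poly_roots_finite)
  then have *: "0 < lead_coeff p * ((-1) ^ card {z \<in> zero_set p. y < z} * (\<Prod>z\<in>zero_set p. y - z))"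
    using assms(3) by (intro mult_pos_pos[OF assms(2)] prod) (simp_all add: zero_set_def)
  have "poly p y = poly (smult (lead_coeff p) (\<Prod>z\<in>zero_set p. [:- z, 1:])) y"
    using poly_eq_prod_zero_set[OF \<open>p \<noteq> 0\<close> assms(1)] by (rule arg_cong)
  then have "poly p y = lead_coeff p * (\<Prod>z\<in>zero_set p. y - z)"
    by (simp only: poly_smult poly_prod) simp
  then have "(-1) ^ card {z \<in> zero_set p. y < z} * poly p y =
      lead_coeff p * ((-1) ^ card {z \<in> zero_set p. y < z} * (\<Prod>z\<in>zero_set p. y - z))"
    by (simp only: mult.left_commute)
  then show ?thesis using * by (simp only:)
qed

text \<open>The real zeros, embedded in the complex numbers, already reach the bound on the number
  of roots, so no other root is left.\<close>

lemma real_rooted_if_card_zero_set: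
  assumes "p \<noteq> 0" "card (zero_set p) = degree p"
  shows "real_rooted p"
  unfolding real_rooted_def
proof (intro allI impI)
  fix z :: complex
  let ?p = "map_poly complex_of_real p"
  assume z: "poly ?p z = 0"
  have "?p \<noteq> 0" using assms(1) by (simp add: map_poly_eq_0_iff)
  have real: "poly ?p (of_real x) = of_real (poly p x)" for x
    by (induction p) (auto simp: map_poly_pCons)
  have "of_real ` zero_set p = {z. poly ?p z = 0}"
  proof (rule card_seteq)
    show "finite {z. poly ?p z = 0}" using \<open>?p \<noteq> 0\<close> by (rule poly_roots_finite)
    show "of_real ` zero_set p \<subseteq> {z. poly ?p z = 0}" by (auto simp: real zero_set_def)
    have "card {z. poly ?p z = 0} \<le> degree ?p" using \<open>?p \<noteq> 0\<close> by (rule card_poly_roots_bound)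
    also have "degree ?p = card (of_real ` zero_set p :: complex set)"
      using assms by (simp add: card_image inj_on_def degree_map_poly)
    finally show "card {z. poly ?p z = 0} \<le> card (of_real ` zero_set p :: complex set)" .
  qed
  then have "z \<in> of_real ` zero_set p" using z by simp
  then show "z \<in> \<real>" by auto
qed

section \<open>The intervals and the signs at their endpoints\<close>

locale recurrence_parameters =
  fixes a b c d :: real
  assumes a_pos: "0 < a" and b_pos: "0 < b" and c_pos: "0 < c" and d_pos: "0 < d"
    and ad_less_bc: "a * d < b * c"
begin

abbreviation P :: "nat \<Rightarrow> real poly" where "P \<equiv> W a b c d"
abbreviation R :: "nat \<Rightarrow> real set" where "R n \<equiv> zero_set (P n)"
abbreviation xA :: real where "xA \<equiv> x_A a b"
abbreviation xm :: real where "xm \<equiv> x_Delta_minus a b c d"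
abbreviation xp :: real where "xp \<equiv> x_Delta_plus a b c d"
abbreviation u :: real where "u \<equiv> u_bound a b c d"
abbreviation v :: real where "v \<equiv> v_bound a b c d"

section \<open>Degree and leading coefficient\<close>

lemma poly_P_rec:
  "poly (P (Suc (Suc n))) x = (a * x + b) * poly (P (Suc n)) x + (c * x + d) * poly (P n) x"
  by (simp add: algebra_simps)

lemma degree_P_le: "degree (P n) \<le> n"
proof (induction n rule: induct_nat_012)
  case (ge2 n)
  have "degree ([:b, a:] * P (Suc n)) \<le> Suc (Suc n)" "degree ([:d, c:] * P n) \<le> Suc (Suc n)"
    using ge2 degree_mult_le[of "[:b, a:]" "P (Suc n)"] degree_mult_le[of "[:d, c:]" "P n"]
    by (auto split: if_splits)
  then show ?case by (simp add: degree_add_le)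
qed auto

lemma coeff_P_pos: "0 < coeff (P n) n"
proof (induction n rule: induct_nat_012)
  case (ge2 n)
  have "coeff (P (Suc n)) (Suc (Suc n)) = 0" "coeff (P n) (Suc n) = 0" "coeff (P n) (Suc (Suc n)) = 0"
    using degree_P_le[of "Suc n"] degree_P_le[of n] by (auto intro!: coeff_eq_0)
  then have "coeff (P (Suc (Suc n))) (Suc (Suc n)) = a * coeff (P (Suc n)) (Suc n)"
    by simp
  then show ?case using ge2 a_pos by (metis mult_pos_pos)
qed auto

lemma degree_P: "degree (P n) = n"
  using degree_P_le[of n] coeff_P_pos[of n] le_degree[of "P n" n] by simp

lemma P_nonzero: "P n \<noteq> 0"
  using coeff_P_pos[of n] by auto

lemma finite_R: "finite (R n)"
  using P_nonzero by (simp add: zero_set_def poly_roots_finite)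

declare W.simps(3) [simp del]

section \<open>The discriminant of the characteristic equation\<close>

lemma Disc_Delta_pos: "0 < Disc_Delta a b c d"
proof -
  have "Disc_Delta a b c d = a * (b * c - a * d) + c\<^sup>2"
    by (simp add: Disc_Delta_def algebra_simps power2_eq_square)
  also have "\<dots> > 0" using a_pos ad_less_bc by (intro add_pos_nonneg mult_pos_pos) auto
  finally show ?thesis .
qed

text \<open>The left side is the discriminant of
  \<open>t\<^sup>2 = (a * x + b) * t + (c * x + d)\<close>, so at \<open>xm\<close> and
  \<open>xp\<close> this equation has a double root.\<close>

lemma Delta_factorization: "(a * x + b)\<^sup>2 + 4 * (c * x + d) = a\<^sup>2 * ((x - xm) * (x - xp))"
proof -
  let ?s = "sqrt (Disc_Delta a b c d)"
  have s: "?s\<^sup>2 = - (a\<^sup>2) * d + a * b * c + c\<^sup>2"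
    using Disc_Delta_pos by (simp add: Disc_Delta_def)
  have xm: "a\<^sup>2 * (x - xm) = a\<^sup>2 * x + a * b + 2 * c + 2 * ?s"
    and xp: "a\<^sup>2 * (x - xp) = a\<^sup>2 * x + a * b + 2 * c - 2 * ?s"
    using a_pos by (simp_all add: x_Delta_minus_def x_Delta_plus_def field_simps)
  have "a\<^sup>2 * (a\<^sup>2 * ((x - xm) * (x - xp))) = (a\<^sup>2 * (x - xm)) * (a\<^sup>2 * (x - xp))"
    by simp
  also have "\<dots> = (a\<^sup>2 * x + a * b + 2 * c)\<^sup>2 - 4 * ?s\<^sup>2"
    unfolding xm xp by (simp add: power2_eq_square algebra_simps)
  also have "\<dots> = a\<^sup>2 * ((a * x + b)\<^sup>2 + 4 * (c * x + d))"
    unfolding s by (simp add: power2_eq_square algebra_simps)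
  finally show ?thesis
    using a_pos mult_left_cancel[of "a\<^sup>2"] by (metis power_not_zero less_irrefl)
qed

lemma xm_less_xp: "xm < xp"
  using Disc_Delta_pos a_pos by (simp add: x_Delta_minus_def x_Delta_plus_def divide_strict_right_mono)

lemma xA_eq: "a * xA + b = 0"
  using a_pos by (simp add: x_A_def)

lemma xA_neg: "xA < 0"
  using a_pos b_pos by (simp add: x_A_def)

lemma ax_plus_b_sign: "0 < a * x + b \<longleftrightarrow> xA < x" "a * x + b < 0 \<longleftrightarrow> x < xA"
proof -
  have "a * x + b = a * (x - xA)" using xA_eq by (simp add: algebra_simps)
  then show "0 < a * x + b \<longleftrightarrow> xA < x" "a * x + b < 0 \<longleftrightarrow> x < xA"
    using a_pos by (simp_all add: zero_less_mult_iff mult_less_0_iff)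
qed

lemma cx_plus_d_neg_xA: "c * xA + d < 0"
  using a_pos ad_less_bc by (simp add: x_A_def field_simps)

text \<open>At \<open>xA\<close> the discriminant is \<open>4 * (c * xA + d)\<close>, negative
  because \<open>a * d < b * c\<close>, so \<open>xA\<close> lies strictly between its
  roots.\<close>

lemma xm_less_xA: "xm < xA" and xA_less_xp: "xA < xp"
proof -
  have "a\<^sup>2 * ((xA - xm) * (xA - xp)) < 0"
    using Delta_factorization[of xA] cx_plus_d_neg_xA xA_eq by simp
  then have "(xA - xm) * (xA - xp) < 0"
    using a_pos by (simp add: mult_less_0_iff)
  then show "xm < xA" "xA < xp"
    using xm_less_xp by (auto simp: mult_less_0_iff)
qed

text \<open>Up to \<open>xA\<close> monotonicity suffices; beyond it the discriminant is nonpositive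
  while \<open>(a * x + b)\<^sup>2\<close> is positive. This makes \<beta> positive on both
  \<open>J1\<close> and \<open>J2\<close>.\<close>

lemma cx_plus_d_neg: "c * x + d < 0" if "x \<le> xp"
proof (cases "x \<le> xA")
  case True
  then have "c * x \<le> c * xA" using c_pos by simp
  then show ?thesis using cx_plus_d_neg_xA by linarith
next
  case False
  then have "(x - xm) * (x - xp) \<le> 0"
    using that xm_less_xA by (simp add: mult_nonneg_nonpos)
  then have "a\<^sup>2 * ((x - xm) * (x - xp)) \<le> 0"
    by (simp add: mult_nonneg_nonpos)
  also have "0 < (a * x + b)\<^sup>2"
    using ax_plus_b_sign(1)[of x] False by simp
  finally have "a\<^sup>2 * ((x - xm) * (x - xp)) - (a * x + b)\<^sup>2 < 0"
    by simp
  then have "4 * (c * x + d) < 0"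
    by (simp only: Delta_factorization[symmetric] add_diff_cancel_left')
  then show ?thesis by simp
qed

lemma xp_neg: "xp < 0"
  using cx_plus_d_neg[of xp] c_pos d_pos by (smt (verit) mult_nonneg_nonneg)

text \<open>Real zeros of \<open>g\<close> are the \<open>x\<close> for which \<open>x\<close> solves the characteristic equation
  \<open>t\<^sup>2 = (a x + b) t + (c x + d)\<close>, so that \<open>W\<^sub>n(x) = x ^ n\<close> there.\<close>

definition g :: "real \<Rightarrow> real" where
  "g x = x\<^sup>2 - (a * x + b) * x - (c * x + d)"

lemma g_eq: "g x = (1 - a) * x\<^sup>2 - (b + c) * x - d"
  by (simp add: g_def power2_eq_square algebra_simps)

lemma poly_P_g_zero: "g x = 0 \<Longrightarrow> poly (P n) x = x ^ n"
proof (induction n rule: induct_nat_012)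
  case (ge2 n)
  have "(a * x + b) * x + (c * x + d) = x\<^sup>2"
    using ge2(3) by (simp add: g_def)
  then have "x ^ Suc (Suc n) = ((a * x + b) * x + (c * x + d)) * x ^ n"
    by (simp add: power2_eq_square)
  then show ?case
    using ge2 unfolding poly_P_rec by (simp add: algebra_simps)
qed auto

lemma Disc_g_nonneg: "0 \<le> Disc_g a b c d"
proof -
  have "Disc_g a b c d = (b - c)\<^sup>2 + 4 * (b * c - a * d) + 4 * d"
    by (simp add: Disc_g_def power2_eq_square algebra_simps)
  then show ?thesis using ad_less_bc d_pos by simp
qed

lemma g_square:
  "4 * (1 - a) * g x = (2 * (1 - a) * x - (b + c))\<^sup>2 - (sqrt (Disc_g a b c d))\<^sup>2"
  using Disc_g_nonneg by (simp add: Disc_g_def g_def power2_eq_square algebra_simps)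

text \<open>The switch from \<open>x_g_minus\<close> to \<open>x_g_plus\<close> at
  \<open>a = 1\<close> compensates the sign of \<open>1 - a\<close> in the absolute value, so one
  formula serves both cases.\<close>

lemma v_eq: "a \<noteq> 1 \<Longrightarrow> 2 * (1 - a) * v - (b + c) = - sqrt (Disc_g a b c d)"
proof -
  assume "a \<noteq> 1"
  have "v = (b + c) / (2 * (1 - a)) - sqrt (Disc_g a b c d) / (2 * (1 - a))"
  proof (cases "a \<le> 1")
    case False
    then have "2 * \<bar>1 - a\<bar> = - (2 * (1 - a))" by simp
    then show ?thesis
      using False by (simp only: v_bound_def x_g_plus_def divide_minus_right) simp
  qed (use \<open>a \<noteq> 1\<close> in \<open>simp add: v_bound_def x_g_minus_def\<close>)
  also have "\<dots> = (b + c - sqrt (Disc_g a b c d)) / (2 * (1 - a))"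
    by (simp only: diff_divide_distrib)
  finally have "2 * (1 - a) * v = b + c - sqrt (Disc_g a b c d)"
    using \<open>a \<noteq> 1\<close> by simp
  then show ?thesis by simp
qed

lemma g_v: "g v = 0"
proof (cases "a = 1")
  case True
  then have "g v = - ((b + c) * v) - d" by (subst g_eq) simp
  moreover have "(b + c) * v = - d"
    using True b_pos c_pos by (simp add: v_bound_def x_g_minus_def)
  ultimately show ?thesis by simp
next
  case False
  then have "4 * (1 - a) * g v = 0"
    unfolding g_square v_eq[OF False] by simp
  then show ?thesis using False by simp
qed

lemma v_neg: "v < 0"
proof (cases "a = 1")
  case True
  then show ?thesis using b_pos c_pos d_pos by (simp add: v_bound_def x_g_minus_def)
next
  case False
  have "4 * (1 - a) * g 0 = (b + c)\<^sup>2 - (sqrt (Disc_g a b c d))\<^sup>2"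
    using g_square[of 0] by (simp add: power2_eq_square algebra_simps)
  then have *: "(b + c)\<^sup>2 - (sqrt (Disc_g a b c d))\<^sup>2 = - (4 * (1 - a) * d)"
    by (simp add: g_def)
  show ?thesis
  proof (cases "a < 1")
    case True
    then have "(b + c)\<^sup>2 < (sqrt (Disc_g a b c d))\<^sup>2" using * d_pos by (smt (verit) mult_pos_pos)
    then have "b + c < sqrt (Disc_g a b c d)" by (rule power_less_imp_less_base) (use Disc_g_nonneg in simp)
    then have "(1 - a) * v < 0" using v_eq[OF False] by linarith
    then show ?thesis using True by (simp add: mult_less_0_iff)
  next
    case nless: False
    then have "(sqrt (Disc_g a b c d))\<^sup>2 < (b + c)\<^sup>2" using * d_pos False by (smt (verit) mult_neg_pos)
    then have "sqrt (Disc_g a b c d) < b + c" by (rule power_less_imp_less_base) (use b_pos c_pos in auto)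
    then have "0 < (1 - a) * v" using v_eq[OF False] by linarith
    then show ?thesis using nless by (simp add: zero_less_mult_iff)
  qed
qed

text \<open>At \<open>xp\<close> the double root \<open>(a * xp + b) / 2\<close> is positive while
  \<open>xp\<close> is negative, so \<open>g xp\<close> is a positive square. For
  \<open>a < 1\<close> this puts \<open>xp\<close> outside the roots of \<open>g\<close>, and
  \<open>?y < 0\<close> selects the left side; for \<open>a > 1\<close> it lies between the roots,
  of which \<open>v\<close> is the larger.\<close>

lemma xp_less_v: "xp < v"
proof -
  have "4 * g xp = (2 * xp - (a * xp + b))\<^sup>2"
    using Delta_factorization[of xp] by (simp add: g_def power2_eq_square algebra_simps)
  moreover have "2 * xp - (a * xp + b) < 0"
    using xp_neg ax_plus_b_sign(1)[of xp] xA_less_xp by linarith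
  ultimately have g_pos: "0 < g xp" by (smt (verit) zero_less_power2)
  let ?s = "sqrt (Disc_g a b c d)"
  let ?y = "2 * (1 - a) * xp - (b + c)"
  consider "a = 1" | "a < 1" | "1 < a" by linarith
  then show ?thesis
  proof cases
    case 1
    then have "g xp = - ((b + c) * xp) - d" by (subst g_eq) simp
    moreover have "(b + c) * v = - d"
      using 1 b_pos c_pos by (simp add: v_bound_def x_g_minus_def)
    ultimately have "(b + c) * xp < (b + c) * v" using g_pos by linarith
    then show ?thesis using b_pos c_pos by simp
  next
    case 2
    then have "?s\<^sup>2 < ?y\<^sup>2"
      using g_square[of xp] g_pos by (smt (verit) mult_pos_pos)
    moreover have "?y < 0"
      using 2 xp_neg b_pos c_pos by (smt (verit) mult_pos_neg)
    ultimately have "?s < - ?y"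
      using power2_less_imp_less[of ?s "- ?y"] by (simp only: power2_minus)
    then have "(1 - a) * xp < (1 - a) * v" using v_eq 2 by linarith
    then show ?thesis using 2 by simp
  next
    case 3
    then have "?y\<^sup>2 < ?s\<^sup>2"
      using g_square[of xp] g_pos by (smt (verit) mult_neg_pos)
    then have "- ?y < ?s"
      using power2_less_imp_less[of "- ?y" ?s] real_sqrt_ge_zero[OF Disc_g_nonneg]
      by (simp only: power2_minus)
    then have "(1 - a) * v < (1 - a) * xp" using v_eq 3 by linarith
    then show ?thesis using 3 by simp
  qed
qed

text \<open>Here \<open>g\<close> opens downwards, so \<open>g xA > 0\<close> puts \<open>xA\<close>
  between its roots, \<open>u\<close> being the smaller one.\<close>

lemma u_large_a:
  assumes "2 < a"
  shows "g u = 0" "u < xA"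
proof -
  let ?s = "sqrt (Disc_g a b c d)"
  have u: "2 * (1 - a) * u - (b + c) = ?s"
  proof -
    have "2 * \<bar>1 - a\<bar> = - (2 * (1 - a))" using assms by simp
    then have "u = (b + c) / (2 * (1 - a)) + ?s / (2 * (1 - a))"
      using assms by (simp only: u_bound_def x_g_minus_def divide_minus_right) simp
    also have "\<dots> = (b + c + ?s) / (2 * (1 - a))"
      by (simp only: add_divide_distrib)
    finally have "2 * (1 - a) * u = b + c + ?s"
      using assms by simp
    then show ?thesis by simp
  qed
  have "4 * (1 - a) * g u = 0" unfolding g_square u by simp
  then show "g u = 0" using assms by simp
  let ?y = "2 * (1 - a) * xA - (b + c)"
  have "g xA = xA\<^sup>2 - (c * xA + d)" using xA_eq by (simp add: g_def)
  then have "0 < g xA" using cx_plus_d_neg_xA by (smt (verit) zero_le_power2)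
  then have "?y\<^sup>2 < ?s\<^sup>2"
    using assms g_square[of xA] by (smt (verit) mult_neg_pos)
  then have "?y < ?s"
    using power2_less_imp_less[of ?y ?s] Disc_g_nonneg by simp
  then have "(1 - a) * xA < (1 - a) * u" using u by linarith
  then show "u < xA" using assms by simp
qed

lemma u_less_xA: "u < xA"
  using u_large_a(2) xm_less_xA by (cases "2 < a") (auto simp: u_bound_def)

end

text \<open>Both characteristic roots equal \<open>h\<close>, so \<open>s (Suc n) - h * s n\<close>
  is multiplied by \<open>h\<close> in each step and stays positive.\<close>

lemma double_root_recurrence_pos:
  fixes s :: "nat \<Rightarrow> real"
  assumes "\<And>n. s (Suc (Suc n)) = 2 * h * s (Suc n) - h\<^sup>2 * s n"
    and "0 < h" "0 < s 0" "h * s 0 < s 1"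
  shows "0 < s n"
proof -
  have "0 < s n \<and> h * s n < s (Suc n)"
  proof (induction n)
    case 0
    then show ?case using assms by simp
  next
    case (Suc n)
    have "s (Suc (Suc n)) - h * s (Suc n) = h * (s (Suc n) - h * s n)"
      by (simp add: assms(1) power2_eq_square algebra_simps)
    moreover have "0 < h * (s (Suc n) - h * s n)" "0 < h * s n"
      using Suc assms(2) by auto
    ultimately show ?case using Suc by linarith
  qed
  then show ?thesis ..
qed

section \<open>Zeros of the polynomials\<close>

context recurrence_parameters
begin

text \<open>The double root case with positive root. The sequence starts at index 1 because
  \<open>W\<^sub>0\<close> is positive, whence the index shift on \<open>J2\<close>; the constant
  sign makes \<open>- xp\<close> the left end after reflection.\<close>

lemma poly_P_xp_neg: "1 \<le> n \<Longrightarrow> poly (P n) xp < 0"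
proof -
  define h where "h = (a * xp + b) / 2"
  have A: "a * xp + b = 2 * h" and B: "c * xp + d = - h\<^sup>2"
    using Delta_factorization[of xp] by (simp_all add: h_def power_divide)
  have "0 < h" using ax_plus_b_sign(1)[of xp] xA_less_xp by (simp add: h_def)
  have "0 < - poly (P (Suc n)) xp" for n
  proof (rule double_root_recurrence_pos[where s = "\<lambda>n. - poly (P (Suc n)) xp" and h = h])
    show "- poly (P (Suc (Suc (Suc n)))) xp =
        2 * h * - poly (P (Suc (Suc n))) xp - h\<^sup>2 * - poly (P (Suc n)) xp" for n
      unfolding poly_P_rec[of "Suc n"] A B by simp
    have "- poly (P (Suc 1)) xp = h * - xp + h * - xp + h\<^sup>2"
      unfolding One_nat_def poly_P_rec A B by simp
    moreover have "0 < h * - xp" "0 < h\<^sup>2"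
      using \<open>0 < h\<close> xp_neg mult_pos_pos[of h "- xp"] by simp_all
    ultimately have "h * - xp < - poly (P (Suc 1)) xp" by linarith
    then show "h * - poly (P (Suc 0)) xp < - poly (P (Suc 1)) xp" by simp
  qed (use \<open>0 < h\<close> xp_neg in simp_all)
  then show "1 \<le> n \<Longrightarrow> poly (P n) xp < 0"
    by (cases n) auto
qed

text \<open>For \<open>a > 2\<close> the polynomial takes the value \<open>u ^ n\<close> with
  \<open>u < 0\<close>. Otherwise \<open>u = xm\<close>, and the sign-adjusted sequence has a
  positive double root.\<close>

lemma poly_P_u_sign: "0 < (-1) ^ n * poly (P n) u"
proof (cases "2 < a")
  case True
  have "(-1) ^ n * poly (P n) u = (- u) ^ n"
    using poly_P_g_zero[OF u_large_a(1)[OF True], of n] by (metis mult_minus1 power_mult_distrib)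
  then show ?thesis
    using u_large_a(2)[OF True] xA_neg by simp
next
  case False
  then have u: "u = xm" by (simp add: u_bound_def)
  define h where "h = - (a * xm + b) / 2"
  have A: "a * xm + b = - 2 * h" by (simp add: h_def)
  have "h\<^sup>2 = (a * xm + b)\<^sup>2 / 4"
    unfolding h_def power_divide power2_minus by simp
  then have B: "c * xm + d = - h\<^sup>2"
    using Delta_factorization[of xm] by simp
  have "0 < h" using ax_plus_b_sign(2)[of xm] xm_less_xA by (simp add: h_def)
  have "xm < 0" using xm_less_xA xA_neg by simp
  show ?thesis unfolding u
  proof (rule double_root_recurrence_pos[where s = "\<lambda>n. (-1) ^ n * poly (P n) xm" and h = h])
    show "(-1) ^ Suc (Suc n) * poly (P (Suc (Suc n))) xm =
        2 * h * ((-1) ^ Suc n * poly (P (Suc n)) xm) - h\<^sup>2 * ((-1) ^ n * poly (P n) xm)" for n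
      unfolding poly_P_rec A B by (simp add: algebra_simps)
    \<comment> \<open>The initial comparison \<open>h < - xm\<close> amounts to
      \<open>(2 - a) * xm < b\<close>. This is where the case distinction at \<open>a = 2\<close> in
      \<open>u_bound\<close> enters.\<close>
    have "(2 - a) * xm \<le> 0" using False \<open>xm < 0\<close> by (simp add: mult_nonneg_nonpos)
    then have "h < - xm"
      using b_pos by (simp add: h_def algebra_simps)
    then show "h * ((-1) ^ 0 * poly (P 0) xm) < (-1) ^ 1 * poly (P 1) xm" by simp
  qed (use \<open>0 < h\<close> in simp_all)
qed

lemma poly_P_xA: "poly (P (Suc (Suc n))) xA = (c * xA + d) * poly (P n) xA"
  unfolding poly_P_rec xA_eq by simp

text \<open>Two steps multiply the value at \<open>xA\<close> by the negative number
  \<open>c * xA + d\<close>; after the change of sign the starting values are \<open>1\<close> and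
  \<open>- xA\<close>.\<close>

lemma poly_P_xA_sign: "0 < (-1) ^ (n div 2) * ((-1) ^ n * poly (P n) xA)"
proof (induction n rule: induct_nat_012)
  case (ge2 n)
  have "0 < - (c * xA + d) * ((-1) ^ (n div 2) * ((-1) ^ n * poly (P n) xA))"
    by (rule mult_pos_pos[OF _ ge2(1)]) (use cx_plus_d_neg_xA in simp)
  then show ?case unfolding poly_P_xA by (simp add: algebra_simps)
qed (use xA_neg in auto)

lemma poly_P_Suc_xA_sign: "0 < (-1) ^ (n div 2) * - poly (P (Suc n)) xA"
proof (induction n rule: induct_nat_012)
  case 0
  then show ?case using xA_neg by simp
next
  case 1
  then show ?case unfolding poly_P_xA using cx_plus_d_neg_xA by simp
next
  case (ge2 n)
  have "0 < - (c * xA + d) * ((-1) ^ (n div 2) * - poly (P (Suc n)) xA)"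
    by (rule mult_pos_pos[OF _ ge2(1)]) (use cx_plus_d_neg_xA in simp)
  then show ?case unfolding poly_P_xA[of "Suc n"] by (simp add: algebra_simps)
qed

text \<open>Only weak, as \<open>W\<^sub>1\<close> vanishes at 0; this is why \<open>J4\<close>
  contains its right end.\<close>

lemma poly_P_0_nonneg: "0 \<le> poly (P n) 0"
proof (induction n rule: induct_nat_012)
  case (ge2 n)
  then show ?case unfolding poly_P_rec using b_pos d_pos by simp
qed auto

text \<open>On \<open>J2\<close> the nodes are counted from the right end, and the index is shifted by one.\<close>

sublocale low: alternating_recurrence "\<lambda>n x. (-1) ^ n * poly (P n) x" "\<lambda>x. - (a * x + b)"
  "\<lambda>x. - (c * x + d)" u xA
proof unfold_locales
  show "(-1) ^ Suc (Suc n) * poly (P (Suc (Suc n))) x =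
      - (a * x + b) * ((-1) ^ Suc n * poly (P (Suc n)) x) - - (c * x + d) * ((-1) ^ n * poly (P n) x)"
    for n x unfolding poly_P_rec by (simp add: algebra_simps)
  show "0 < - (a * x + b)" if "u < x" "x < xA" for x
    using that ax_plus_b_sign(2)[of x] by simp
  show "0 < - (c * x + d)" if "u < x" "x < xA" for x
    using that cx_plus_d_neg[of x] xA_less_xp by simp
qed (use u_less_xA poly_P_u_sign poly_P_xA_sign in \<open>auto intro!: continuous_intros\<close>)

sublocale high: alternating_recurrence "\<lambda>n x. - poly (P (Suc n)) (- x)" "\<lambda>x. a * - x + b"
  "\<lambda>x. - (c * - x + d)" "- xp" "- xA"
proof unfold_locales
  show "- poly (P (Suc (Suc (Suc n)))) (- x) = (a * - x + b) * - poly (P (Suc (Suc n))) (- x) -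
      - (c * - x + d) * - poly (P (Suc n)) (- x)" for n x
    unfolding poly_P_rec[of "Suc n"] by (simp add: algebra_simps)
  show "0 < a * - x + b" if "- xp < x" "x < - xA" for x
    using that ax_plus_b_sign(1)[of "- x"] by simp
  show "0 < - (c * - x + d)" if "- xp < x" "x < - xA" for x
    using that cx_plus_d_neg[of "- x"] by simp
  show "0 < (-1) ^ (n div 2) * - poly (P (Suc n)) (- (- xA))" for n
    using poly_P_Suc_xA_sign[of n] by simp
qed (use xA_less_xp poly_P_xp_neg in \<open>auto intro!: continuous_intros\<close>)

lemma low_Z: "low.Z n = R n \<inter> J1 a b c d"
  by (auto simp: low.Z_def zero_set_def J1_def)

lemma high_Z: "high.Z n = uminus ` (R (Suc n) \<inter> J2 a b c d)"
proof -
  have "x \<in> uminus ` S \<longleftrightarrow> - x \<in> S" for x :: real and S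
    by (metis image_iff minus_minus)
  then show ?thesis
    by (auto simp: high.Z_def zero_set_def J2_def)
qed

text \<open>\<open>W\<^sub>n\<close> is negative at \<open>xp\<close>, equals \<open>v ^ n\<close>
  at \<open>v\<close> and is nonnegative at 0; the parity of \<open>n\<close> decides on which side
  of \<open>v\<close> the zero falls.\<close>

lemma outer_zero:
  assumes "1 \<le> n"
  obtains w where "w \<in> R n" "w \<in> (if even n then J3 a b c d else J4 a b c d)"
proof (cases "even n")
  case True
  have "0 < poly (P n) v"
    using poly_P_g_zero[OF g_v, of n] v_neg True by (simp add: zero_less_power_eq)
  then obtain w where "xp < w" "w < v" "poly (P n) w = 0"
    using poly_IVT_pos[OF xp_less_v poly_P_xp_neg[OF assms]] by auto
  then show ?thesis using True by (intro that[of w]) (auto simp: zero_set_def J3_def)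
next
  case False
  have neg: "poly (P n) v < 0"
    using poly_P_g_zero[OF g_v, of n] v_neg False by (simp add: power_less_zero_eq)
  obtain w where "v < w" "w \<le> 0" "poly (P n) w = 0"
  proof (cases "poly (P n) 0 = 0")
    case True
    then show ?thesis using v_neg that[of 0] by simp
  next
    case False
    then have "0 < poly (P n) 0" using poly_P_0_nonneg[of n] by simp
    then show ?thesis
      using poly_IVT_pos[OF v_neg neg] that by (meson less_imp_le)
  qed
  then show ?thesis using False by (intro that[of w]) (auto simp: zero_set_def J4_def)
qed

text \<open>With the outer zero \<open>w\<close> the lower bounds add up to
  \<open>n div 2 + (n - 1) div 2 + 1 = n\<close>, the degree. So all inequalities are equalities and
  no further zero exists.\<close>

lemma zeros_exact:
  assumes "1 \<le> n" "n div 2 \<le> card (R n \<inter> J1 a b c d)" "(n - 1) div 2 \<le> card (R n \<inter> J2 a b c d)"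
  shows "card (R n) = n" "card (R n \<inter> J1 a b c d) = n div 2" "card (R n \<inter> J2 a b c d) = (n - 1) div 2"
    and "\<exists>w. R n = (R n \<inter> J1 a b c d) \<union> (R n \<inter> J2 a b c d) \<union> {w} \<and> xp < w \<and>
      w \<in> (if even n then J3 a b c d else J4 a b c d)"
proof -
  obtain w where w: "w \<in> R n" "w \<in> (if even n then J3 a b c d else J4 a b c d)"
    using outer_zero[OF assms(1)] by blast
  have "xp < w"
    using w(2) xp_less_v by (auto simp: J3_def J4_def split: if_splits)
  define S where "S = (R n \<inter> J1 a b c d) \<union> (R n \<inter> J2 a b c d) \<union> {w}"
  have "w \<notin> J1 a b c d" "w \<notin> J2 a b c d"
    using \<open>xp < w\<close> xA_less_xp by (auto simp: J1_def J2_def)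
  moreover have "J1 a b c d \<inter> J2 a b c d = {}"
    by (auto simp: J1_def J2_def)
  ultimately have S: "card S = Suc (card (R n \<inter> J1 a b c d) + card (R n \<inter> J2 a b c d))"
    unfolding S_def using finite_R[of n] by (subst card_Un_disjoint; auto)+
  have "S \<subseteq> R n" using w(1) by (auto simp: S_def)
  have le: "card (R n) \<le> n"
    using card_poly_roots_bound[OF P_nonzero[of n]] by (simp add: zero_set_def degree_P)
  have S_le: "card S \<le> card (R n)"
    using \<open>S \<subseteq> R n\<close> finite_R by (intro card_mono)
  have n: "n = Suc (n div 2 + (n - 1) div 2)"
    using assms(1) by presburger
  show "card (R n) = n" "card (R n \<inter> J1 a b c d) = n div 2" "card (R n \<inter> J2 a b c d) = (n - 1) div 2"
    using assms(2,3) S le S_le n by linarith+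
  have "card (R n) \<le> card S"
    using assms(2,3) S le n by linarith
  then have "S = R n"
    by (rule card_seteq[OF finite_R \<open>S \<subseteq> R n\<close>])
  with w(2) \<open>xp < w\<close> show "\<exists>w. R n = (R n \<inter> J1 a b c d) \<union> (R n \<inter> J2 a b c d) \<union> {w} \<and> xp < w \<and>
      w \<in> (if even n then J3 a b c d else J4 a b c d)"
    unfolding S_def by blast
qed

text \<open>With all zeros located, the sign at a point follows from the number of zeros above it;
  it remains to express this through the count below \<open>y\<close> in
  \<open>tame\<close>.\<close>

lemma tame_if_card_ge:
  assumes "1 \<le> n" "n div 2 \<le> card (R n \<inter> J1 a b c d)" "(n - 1) div 2 \<le> card (R n \<inter> J2 a b c d)"
  shows "low.tame n" "high.tame (n - 1)"
proof -
  obtain w where w: "R n = (R n \<inter> J1 a b c d) \<union> (R n \<inter> J2 a b c d) \<union> {w}" "xp < w"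
    using zeros_exact(4)[OF assms] by blast
  note card = zeros_exact(1-3)[OF assms]
  have sign: "0 < (-1) ^ card {z \<in> R n. y < z} * poly (P n) y" if "poly (P n) y \<noteq> 0" for y
    using card(1) coeff_P_pos[of n] that by (intro poly_sign_zero_set) (auto simp: degree_P)
  have Suc: "Suc (n - 1) = n" using assms(1) by simp
  show "low.tame n"
    unfolding low.tame_def low_Z
  proof (intro conjI allI impI)
    fix y assume y: "u < y" "y < xA" "(-1) ^ n * poly (P n) y \<noteq> 0"
    let ?k = "card {z \<in> R n. y < z}" and ?m = "card {x \<in> R n \<inter> J1 a b c d. x < y}"
    \<comment> \<open>\<open>J2\<close> and \<open>w\<close> lie above \<open>xA\<close>, so zeros
      below \<open>y\<close> are in \<open>J1\<close>. Hence the two counts \<open>?k\<close> and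
      \<open>?m\<close> add up to \<open>n\<close>, and \<open>(-1) ^ n\<close> converts one into
      the other.\<close>
    have "z \<in> J1 a b c d" if "z \<in> R n" "z < y" for z
    proof -
      have "z \<in> (R n \<inter> J1 a b c d) \<union> (R n \<inter> J2 a b c d) \<union> {w}"
        using that(1) w(1) by blast
      then show ?thesis
        using that(2) y(2) w(2) xA_less_xp by (auto simp: J2_def)
    qed
    moreover have "z < y" if "z \<in> R n" "\<not> y < z" for z
      using that y(3) by (cases "z = y") (auto simp: zero_set_def)
    ultimately have "R n = {z \<in> R n. y < z} \<union> {x \<in> R n \<inter> J1 a b c d. x < y}"
      by blast
    then have "card (R n) = card ({z \<in> R n. y < z} \<union> {x \<in> R n \<inter> J1 a b c d. x < y})"
      by (rule arg_cong)
    also have "\<dots> = ?k + ?m"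
      using finite_R[of n] by (intro card_Un_disjoint) auto
    finally have "n = ?k + ?m" using card(1) by simp
    then have "(-1) ^ n = (-1 :: real) ^ (?k + ?m)" by (rule arg_cong)
    then have "(-1) ^ ?m * ((-1) ^ n * poly (P n) y) =
        (-1) ^ ?m * ((-1) ^ ?m * ((-1) ^ ?k * poly (P n) y))"
      by (simp only: power_add mult_ac)
    also have "\<dots> = (-1) ^ ?k * poly (P n) y" by (rule left_minus_one_mult_self)
    finally show "0 < (-1) ^ ?m * ((-1) ^ n * poly (P n) y)"
      using sign[of y] y(3) by (simp only:) simp
  qed (use finite_R card in auto)
  show "high.tame (n - 1)"
    unfolding high.tame_def high_Z Suc
  proof (intro conjI allI impI)
    show "card (uminus ` (R n \<inter> J2 a b c d)) = (n - 1) div 2"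
      using card(3) by (simp add: card_image)
    fix y assume y: "- xp < y" "y < - xA" "- poly (P n) (- y) \<noteq> 0"
    let ?Y = "{x \<in> uminus ` (R n \<inter> J2 a b c d). x < y}"
    \<comment> \<open>Reflection turns the zeros of \<open>J2\<close> above \<open>- y\<close> into
      those below \<open>y\<close>; the one extra zero \<open>w\<close> accounts for the minus sign
      in \<open>high\<close>.\<close>
    have "{z \<in> R n. - y < z} = insert w (uminus ` ?Y)"
    proof (intro equalityI subsetI)
      fix z assume z: "z \<in> {z \<in> R n. - y < z}"
      then have "z \<in> (R n \<inter> J1 a b c d) \<union> (R n \<inter> J2 a b c d) \<union> {w}"
        using w(1) by blast
      moreover have "z \<notin> J1 a b c d" using z y(2) by (auto simp: J1_def)
      moreover have "z \<in> uminus ` ?Y" if "z \<in> R n \<inter> J2 a b c d"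
        using that z by (intro image_eqI[of _ _ "- z"]) auto
      ultimately show "z \<in> insert w (uminus ` ?Y)" by blast
    next
      fix z assume "z \<in> insert w (uminus ` ?Y)"
      moreover have "w \<in> R n" using w(1) by blast
      moreover have "- y < w" using w(2) y(1) by linarith
      ultimately show "z \<in> {z \<in> R n. - y < z}" by auto
    qed
    moreover have "w \<notin> uminus ` ?Y" using w(2) by (auto simp: J2_def)
    moreover have "finite ?Y" using finite_R[of n] by simp
    ultimately have "card {z \<in> R n. - y < z} = Suc (card ?Y)"
      by (simp add: card_image)
    then show "0 < (-1) ^ card ?Y * - poly (P n) (- y)"
      using sign[of "- y"] y(3) by simp
  qed (use finite_R in auto)
qed

text \<open>Tame smaller indices give lower bounds on \<open>J1\<close> and \<open>J2\<close>
  separately, but only both together reach the degree and yield tameness at \<open>n\<close>. Hence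
  one joint strong induction.\<close>

lemma card_zeros_ge_and_tame:
  "n div 2 \<le> card (R n \<inter> J1 a b c d) \<and> (n - 1) div 2 \<le> card (R n \<inter> J2 a b c d) \<and>
    low.tame n \<and> high.tame (n - 1)"
proof (induction n rule: less_induct)
  case (less n)
  show ?case
  proof (cases "n = 0")
    case True
    \<comment> \<open>As \<open>0 - 1 = 0\<close>, the claim for \<open>n = 0\<close> contains
      \<open>high.tame 0\<close>, a statement about \<open>W\<^sub>1\<close>.\<close>
    have "high.tame (1 - 1)"
      by (rule tame_if_card_ge(2)) auto
    moreover have "low.tame 0"
      by (simp add: low.tame_def low_Z zero_set_def)
    ultimately show ?thesis using True by simp
  next
    case False
    have low: "n div 2 \<le> card (R n \<inter> J1 a b c d)"
      using low.card_Z_ge[of n] less finite_R[of n] by (simp add: low_Z)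
    have "high.tame k" if "k < n - 1" for k
      using less[of "Suc k"] that by simp
    then have "(n - 1) div 2 \<le> card (high.Z (n - 1))"
      using finite_R by (intro high.card_Z_ge) (simp_all add: high_Z)
    then have high: "(n - 1) div 2 \<le> card (R n \<inter> J2 a b c d)"
      using False by (simp add: high_Z card_image)
    show ?thesis
      using low high tame_if_card_ge[OF _ low high] False by simp
  qed
qed

section \<open>Counts and interlacing for all indices\<close>

lemmas R_decomposition = zeros_exact[OF _ card_zeros_ge_and_tame[THEN conjunct1] card_zeros_ge_and_tame[THEN conjunct2, THEN conjunct1]]

lemma low_tame: "low.tame n" and high_tame: "high.tame n"
  using card_zeros_ge_and_tame[of n] card_zeros_ge_and_tame[of "Suc n"] by simp_all

lemma real_rooted_P: "real_rooted (P n)"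
proof (cases "n = 0")
  case False
  then show ?thesis
    using R_decomposition(1)[of n] by (intro real_rooted_if_card_zero_set P_nonzero) (simp add: degree_P)
qed (simp add: real_rooted_def)

lemma card_J3: "1 \<le> n \<Longrightarrow> card (R (2 * n) \<inter> J3 a b c d) = 1"
proof -
  assume "1 \<le> n"
  then obtain w where "R (2 * n) = (R (2 * n) \<inter> J1 a b c d) \<union> (R (2 * n) \<inter> J2 a b c d) \<union> {w}"
    "w \<in> J3 a b c d"
    using R_decomposition(4)[of "2 * n"] by auto
  then have "R (2 * n) \<inter> J3 a b c d = {w}"
    using xA_less_xp by (auto simp: J1_def J2_def J3_def)
  then show ?thesis by simp
qed

lemma card_J4: "1 \<le> n \<Longrightarrow> card (R (2 * n - 1) \<inter> J4 a b c d) = 1"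
proof -
  assume "1 \<le> n"
  then have "odd (2 * n - 1)" "1 \<le> 2 * n - 1" by auto
  then obtain w where "R (2 * n - 1) = (R (2 * n - 1) \<inter> J1 a b c d) \<union> (R (2 * n - 1) \<inter> J2 a b c d) \<union> {w}"
    "w \<in> J4 a b c d"
    using R_decomposition(4)[of "2 * n - 1"] by auto
  then have "R (2 * n - 1) \<inter> J4 a b c d = {w}"
    using xA_less_xp xp_less_v by (auto simp: J1_def J2_def J4_def)
  then show ?thesis by simp
qed

text \<open>The recurrence gives interlacing from the left for every \<open>n\<close>. For even
  \<open>n\<close> the count \<open>n div 2\<close> exceeds \<open>(n - k) div 2\<close> by one, so
  the alternation can be reversed.\<close>

lemma interlacing_J1:
  assumes "k \<in> {1, 2}" "k + 1 \<le> n"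
  shows "strictly_interlaces_left (R n \<inter> J1 a b c d) (R (n - k) \<inter> J1 a b c d)"
    and "even n \<Longrightarrow> strictly_interlaces_right (R n \<inter> J1 a b c d) (R (n - k) \<inter> J1 a b c d)"
proof -
  define m where "m = n - k"
  have "n = Suc m \<or> n = Suc (Suc m)"
    using assms by (auto simp: m_def)
  then show left: "strictly_interlaces_left (R n \<inter> J1 a b c d) (R (n - k) \<inter> J1 a b c d)"
    using low.strictly_interlaces_Suc[OF low_tame, of m]
      low.strictly_interlaces_Suc_Suc[OF low_tame, of m]
    unfolding m_def[symmetric] low_Z by metis
  assume "even n"
  have "n div 2 = Suc ((n - k) div 2)"
    using assms \<open>even n\<close> by auto
  then show "strictly_interlaces_right (R n \<inter> J1 a b c d) (R (n - k) \<inter> J1 a b c d)"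
    using assms R_decomposition(2)[of n] R_decomposition(2)[of "n - k"]
    by (intro strictly_interlaces_right_if_left left) simp
qed

text \<open>After reflection the natural direction is from the right, and now odd \<open>n\<close>
  is the case in which the counts differ by one.\<close>

lemma interlacing_J2:
  assumes "k \<in> {1, 2}" "k + 1 \<le> n"
  shows "strictly_interlaces_right (R n \<inter> J2 a b c d) (R (n - k) \<inter> J2 a b c d)"
    and "odd n \<Longrightarrow> strictly_interlaces_left (R n \<inter> J2 a b c d) (R (n - k) \<inter> J2 a b c d)"
proof -
  let ?X = "uminus ` (R n \<inter> J2 a b c d)" and ?Y = "uminus ` (R (n - k) \<inter> J2 a b c d)"
  have minus: "uminus ` uminus ` S = S" for S :: "real set"
    by (simp add: image_image)
  \<comment> \<open>\<open>high.Z m\<close> belongs to \<open>W\<close> with index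
    \<open>m + 1\<close>, and \<open>k + 1 \<le> n\<close> ensures that \<open>n - k\<close> has
    this form.\<close>
  define m where "m = n - k - 1"
  have "n - k = Suc m"
    using assms by (simp add: m_def)
  have "n = Suc (Suc m) \<or> n = Suc (Suc (Suc m))"
    using assms by (auto simp: m_def)
  then have left: "strictly_interlaces_left ?X ?Y"
    using high.strictly_interlaces_Suc[OF high_tame, of m]
      high.strictly_interlaces_Suc_Suc[OF high_tame, of m]
    unfolding high_Z \<open>n - k = Suc m\<close> by metis
  show "strictly_interlaces_right (R n \<inter> J2 a b c d) (R (n - k) \<inter> J2 a b c d)"
    using strictly_interlaces_left_uminus[OF left] by (simp only: minus)
  assume "odd n"
  have "(n - 1) div 2 = Suc ((n - k - 1) div 2)"
    using assms \<open>odd n\<close> by (auto elim!: oddE)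
  then have "card ?X = Suc (card ?Y)"
    using assms R_decomposition(3)[of n] R_decomposition(3)[of "n - k"] by (simp add: card_image)
  then have "strictly_interlaces_right ?X ?Y"
    by (rule strictly_interlaces_right_if_left[OF left])
  then show "strictly_interlaces_left (R n \<inter> J2 a b c d) (R (n - k) \<inter> J2 a b c d)"
    using strictly_interlaces_right_uminus[of ?X ?Y] by (simp only: minus)
qed

end

theorem theorem3p3:
  fixes a b c d :: real
    and R :: "nat \<Rightarrow> real set"
  assumes "a > 0" and "b > 0" and "c > 0" and "d > 0"
    and "a * d < b * c"
  defines "R \<equiv> \<lambda>n. zero_set (W a b c d n)"
  shows "(\<forall>n. real_rooted (W a b c d n)) \<and>
    (\<forall>n\<ge>1. card (R n \<inter> J1 a b c d) = n div 2 \<and>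
            card (R n \<inter> J2 a b c d) = (n - 1) div 2 \<and>
            card (R (2 * n) \<inter> J3 a b c d) = 1 \<and>
            card (R (2 * n - 1) \<inter> J4 a b c d) = 1) \<and>
    (\<forall>k\<in>{1, 2}. \<forall>J\<in>{J1 a b c d, J2 a b c d}. \<forall>n\<ge>k + 1.
            (odd n \<longrightarrow> strictly_interlaces_left (R n \<inter> J) (R (n - k) \<inter> J)) \<and>
            (even n \<longrightarrow> strictly_interlaces_right (R n \<inter> J) (R (n - k) \<inter> J)))"
proof -
  interpret recurrence_parameters a b c d
    using assms by unfold_locales
  show ?thesis
    unfolding R_def
  proof (intro conjI ballI allI impI)
    fix k n :: nat and J
    assume k: "k \<in> {1, 2}" "k + 1 \<le> n" and "J \<in> {J1 a b c d, J2 a b c d}"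
    then consider "J = J1 a b c d" | "J = J2 a b c d" by blast
    note J = this
    show "strictly_interlaces_left (zero_set (P n) \<inter> J) (zero_set (P (n - k)) \<inter> J)" if "odd n"
      using J interlacing_J1(1)[OF k] interlacing_J2(2)[OF k that] by cases simp_all
    show "strictly_interlaces_right (zero_set (P n) \<inter> J) (zero_set (P (n - k)) \<inter> J)" if "even n"
      using J interlacing_J1(2)[OF k that] interlacing_J2(1)[OF k] by cases simp_all
  qed (simp_all only: real_rooted_P R_decomposition(2,3) card_J3 card_J4)
qed

end
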